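(* Let $(Y,Z)$ be a random vector with $Y$ taking values in $\mathbb{R}^d$ and $Z$ in $\mathbb{R}^k$, defined on the product probability space $(\Omega,\mathcal{A},\mathrm{P})=(\Omega_0,\mathcal{A}_0,\mathrm{P}_0)\times(\Omega_1,\mathcal{A}_1,\mathrm{P}_1)\times((0,1),\mathcal{B}(0,1),\mathrm{Leb})$ (where the second factor carries $(Y,Z)$, the first carries random vectors with distribution $F_U$, and the last is the unit interval with Lebesgue measure). Let $F_U$ be a distribution on $\mathbb{R}^d$ with a Lebesgue density and convex support $\mathcal{U}$. Assume that for each $z$ in the support $\mathcal{Z}$ of $Z$, the conditional distribution $F_{Y\mid Z}(\cdot,z)$ of $Y$ given $Z=z$ has a density with respect to Lebesgue measure on $\mathbb{R}^d$. Let $Q_{Y\mid Z}$ be a measurable map on $\mathcal{UZ}$ (the support of $F_U\otimes F_Z$) such that for each $z\in\mathcal{Z}$, $u\mapsto Q_{Y\mid Z}(u,z)$ is the ($F_U$-a.e. unique) gradient of a convex function pushing $F_U$ forward to $F_{Y\mid Z}(\cdot,z)$. Then there exists a measurable map $(y,z)\mapsto Q^{-1}_{Y\mid Z}(y,z)$ from $\mathcal{YZ}$ (the support of the joint distribution of $(Y,Z)$) to $\mathbb{R}^d$ such that for each $z\in\mathcal{Z}$, $Q^{-1}_{Y\mid Z}(Q_{Y\mid Z}(u,z),z)=u$ for $F_U$-almost every $u$. Furthermore, the random vector $U:=Q^{-1}_{Y\mid Z}(Y,Z)$ satisfies $U\mid Z\sim F_U$ and $Y=Q_{Y\mid Z}(U,Z)$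 $\mathrm{P}$-almost surely.
   Context: $U\mid Z\sim F_U$ means the conditional distribution of $U$ given $Z$ is $F_U$ (so $U$ is independent of $Z$ with law $F_U$). A map $T$ pushes $F_U$ forward to a distribution $G$ if $T(V)\sim G$ whenever $V\sim F_U$. *)

theory Defs
  imports "HOL-Probability.Probability"
begin

definition msupport :: "'a::topological_space measure \<Rightarrow> 'a set" where
  "msupport \<mu> = {x. \<forall>S. open S \<longrightarrow> x \<in> S \<longrightarrow> emeasure \<mu> S > 0}"

definition has_lebesgue_density :: "'a::euclidean_space measure \<Rightarrow> bool" where
  "has_lebesgue_density \<mu> \<longleftrightarrow> (\<exists>f \<in> borel_measurable borel. \<mu> = density lborel f)"

definition cond_distr :: "'w measure \<Rightarrow> ('w \<Rightarrow> 'y::topological_space)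
    \<Rightarrow> ('w \<Rightarrow> 'z::topological_space) \<Rightarrow> ('z \<Rightarrow> 'y measure) \<Rightarrow> bool" where
  "cond_distr M Y Z K \<longleftrightarrow>
     (\<forall>z. prob_space (K z) \<and> sets (K z) = sets borel) \<and>
     (\<forall>A \<in> sets borel. (\<lambda>z. emeasure (K z) A) \<in> borel_measurable borel) \<and>
     (\<forall>A \<in> sets borel. \<forall>B \<in> sets borel.
        emeasure M {\<omega> \<in> space M. Y \<omega> \<in> A \<and> Z \<omega> \<in> B}
          = (\<integral>\<^sup>+ z. indicator B z * emeasure (K z) A \<partial>distr M borel Z))"

text \<open>g (on R^d) is, F-a.e., the gradient of a convex function: there is a convex
  set C and a convex function psi on C (i.e. a convex function with values in
  R \<union> {+\<infinity>} whose effective domain is C) such that F-a.e. u lies in the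
  interior of C, psi is differentiable at u, and its gradient is g u.\<close>
definition ae_gradient_of_convex :: "'a::euclidean_space measure \<Rightarrow> ('a \<Rightarrow> 'a) \<Rightarrow> bool" where
  "ae_gradient_of_convex F g \<longleftrightarrow>
     (\<exists>C \<psi>. convex C \<and> convex_on C \<psi> \<and>
        (AE u in F. u \<in> interior C \<and> (\<psi> has_derivative (\<lambda>h. g u \<bullet> h)) (at u)))"

end

theory Submission
  imports Defs
begin

text \<open>
  For fixed \<open>z\<close> the map \<open>T = Q(\<cdot>, z)\<close> is, up to an \<open>F_U\<close>-null set, a gradient of a convex function,
  hence monotone. The support \<open>G\<close> of the law of \<open>(V, T V)\<close>, \<open>V \<sim> F_U\<close>, is therefore a closed monotone
  relation, and the set of \<open>y\<close> with two distinct \<open>G\<close>-preimages is Lebesgue null. As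
  \<open>T V\<close> has a density, almost every \<open>u\<close> is the only \<open>G\<close>-preimage of \<open>T u\<close>. The coordinates of this
  preimage are infima of rationals selected by positivity of \<open>F_U\<close>-measures of sets depending
  measurably on \<open>(y, z)\<close>, so the inverse is jointly Borel without any selection theorem. Finally
  \<open>(Y, Z)\<close> has the law of \<open>(Q(V, W), W)\<close> with \<open>(V, W) \<sim> F_U \<otimes> F_Z\<close>, and both claims about
  \<open>U\<close> transfer along this identity.
\<close>

section \<open>Supports of Borel measures and of their products\<close>

lemma closed_msupport: "closed (msupport \<mu>)"
proof -
  have "- msupport \<mu> = \<Union>{S. open S \<and> emeasure \<mu> S = 0}"
    by (auto simp: msupport_def)
  then have "open (- msupport \<mu>)"
    by (auto intro: open_Union)
  then show ?thesis
    by (simp add: closed_def)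
qed

text \<open>The complement of the support is the union of all open null sets. By Lindelof, countably
  many of them already cover it, so it is null.\<close>

lemma AE_msupport:
  fixes \<mu> :: "'a::second_countable_topology measure"
  assumes "sets \<mu> = sets borel"
  shows "AE x in \<mu>. x \<in> msupport \<mu>"
proof -
  obtain \<F> where \<F>: "\<F> \<subseteq> {S. open S \<and> emeasure \<mu> S = 0}" "countable \<F>"
    "\<Union>\<F> = \<Union>{S. open S \<and> emeasure \<mu> S = 0}"
    by (rule Lindelof[of "{S. open S \<and> emeasure \<mu> S = 0}"]) auto
  have "(\<Union>S\<in>\<F>. S) \<in> null_sets \<mu>"
    using \<F>(1,2) assms by (intro null_sets_UN') (auto intro!: null_setsI)
  moreover have "{x \<in> space \<mu>. x \<notin> msupport \<mu>} \<subseteq> (\<Union>S\<in>\<F>. S)"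
    using \<F>(3) by (simp add: msupport_def) blast
  ultimately show ?thesis
    by (rule AE_I')
qed

text \<open>Every neighbourhood of \<open>(x, y)\<close> contains an open rectangle, whose measure
  is a product of two positive numbers. This places \<open>(u, z)\<close> in the domain on which
  \<open>Q\<close> is controlled.\<close>

lemma msupport_pair_measure:
  fixes \<mu> :: "'a::second_countable_topology measure" and \<nu> :: "'b::second_countable_topology measure"
  assumes "sigma_finite_measure \<nu>"
    and "sets \<mu> = sets borel" "sets \<nu> = sets borel"
    and x: "x \<in> msupport \<mu>" and y: "y \<in> msupport \<nu>"
  shows "(x, y) \<in> msupport (\<mu> \<Otimes>\<^sub>M \<nu>)"
  unfolding msupport_def
proof (intro CollectI allI impI)
  fix S :: "('a \<times> 'b) set" assume "open S" "(x, y) \<in> S"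
  then obtain A B where AB: "open A" "open B" "x \<in> A" "y \<in> B" "A \<times> B \<subseteq> S"
    by (auto simp: open_prod_def)
  interpret sigma_finite_measure \<nu> by fact
  have sets: "sets (\<mu> \<Otimes>\<^sub>M \<nu>) = sets (borel :: ('a \<times> 'b) measure)"
    unfolding borel_prod[symmetric] by (rule sets_pair_measure_cong[OF assms(2,3)])
  have "0 < emeasure \<mu> A * emeasure \<nu> B"
    using x y AB unfolding msupport_def by (simp add: ennreal_zero_less_mult_iff)
  also have "\<dots> = emeasure (\<mu> \<Otimes>\<^sub>M \<nu>) (A \<times> B)"
    using AB assms(2,3) by (intro emeasure_pair_measure_Times[symmetric]) auto
  also have "\<dots> \<le> emeasure (\<mu> \<Otimes>\<^sub>M \<nu>) S"
    using \<open>open S\<close> AB(5) sets by (intro emeasure_mono) auto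
  finally show "0 < emeasure (\<mu> \<Otimes>\<^sub>M \<nu>) S" .
qed

section \<open>Monotonicity of gradients of convex functions\<close>

text \<open>On the segment from \<open>x\<close> to \<open>y\<close>, convexity bounds each
  difference quotient at \<open>x\<close> by \<open>\<psi> y - \<psi> x\<close>; the right limit of
  these quotients is the directional derivative.\<close>

lemma convex_gradient_inequality:
  fixes \<psi> :: "'a::euclidean_space \<Rightarrow> real"
  assumes cvx: "convex_on C \<psi>" and x: "x \<in> C" and y: "y \<in> C"
    and der: "(\<psi> has_derivative (\<lambda>h. g \<bullet> h)) (at x)"
  shows "\<psi> x + g \<bullet> (y - x) \<le> \<psi> y"
proof -
  have "((\<lambda>t. \<psi> (x + t *\<^sub>R (y - x))) has_derivative (\<lambda>t. g \<bullet> (t *\<^sub>R (y - x)))) (at (0::real))"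
    by (rule has_derivative_compose[where g = \<psi> and g' = "\<lambda>h. g \<bullet> h"])
       (auto intro!: derivative_eq_intros simp: der)
  then have "((\<lambda>t. \<psi> (x + t *\<^sub>R (y - x))) has_real_derivative (g \<bullet> (y - x))) (at 0)"
    by (simp add: has_field_derivative_def mult_commute_abs)
  then have "((\<lambda>t. (\<psi> (x + t *\<^sub>R (y - x)) - \<psi> x) / t) \<longlongrightarrow> g \<bullet> (y - x)) (at_right 0)"
    by (auto simp: has_field_derivative_iff intro: filterlim_at_split[THEN iffD1, THEN conjunct2])
  moreover have "\<forall>\<^sub>F t in at_right 0. (\<psi> (x + t *\<^sub>R (y - x)) - \<psi> x) / t \<le> \<psi> y - \<psi> x"
    unfolding eventually_at_right_field
  proof (intro exI[of _ 1] conjI allI impI)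
    fix t :: real assume t: "0 < t" "t < 1"
    have "x + t *\<^sub>R (y - x) = (1 - t) *\<^sub>R x + t *\<^sub>R y"
      by (simp add: algebra_simps)
    then have "\<psi> (x + t *\<^sub>R (y - x)) \<le> (1 - t) * \<psi> x + t * \<psi> y"
      using convex_onD[OF cvx, of t x y] t x y by simp
    then show "(\<psi> (x + t *\<^sub>R (y - x)) - \<psi> x) / t \<le> \<psi> y - \<psi> x"
      using t by (simp add: field_simps)
  qed simp
  ultimately have "g \<bullet> (y - x) \<le> \<psi> y - \<psi> x"
    by (rule tendsto_upperbound) simp
  then show ?thesis by simp
qed

text \<open>All that is kept of convexity. One full set \<open>D\<close> serves for both points, so
  witnesses may be drawn from any two sets of positive measure.\<close>

definition AE_monotone :: "'a::euclidean_space measure \<Rightarrow> ('a \<Rightarrow> 'a) \<Rightarrow> bool" where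
  "AE_monotone F T \<longleftrightarrow>
     (\<exists>D. (AE u in F. u \<in> D) \<and> (\<forall>u\<in>D. \<forall>v\<in>D. 0 \<le> (u - v) \<bullet> (T u - T v)))"

text \<open>Add the gradient inequalities at \<open>u\<close> and at \<open>v\<close>; the values of
  \<open>\<psi>\<close> cancel.\<close>

lemma AE_monotone_gradient:
  assumes "ae_gradient_of_convex F g"
  shows "AE_monotone F g"
proof -
  obtain C \<psi> where cvx: "convex_on C \<psi>"
    and AE: "AE u in F. u \<in> interior C \<and> (\<psi> has_derivative (\<lambda>h. g u \<bullet> h)) (at u)"
    using assms unfolding ae_gradient_of_convex_def by blast
  let ?D = "{u. u \<in> interior C \<and> (\<psi> has_derivative (\<lambda>h. g u \<bullet> h)) (at u)}"
  have "0 \<le> (u - v) \<bullet> (g u - g v)" if "u \<in> ?D" "v \<in> ?D" for u v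
  proof -
    have "\<psi> u + g u \<bullet> (v - u) \<le> \<psi> v" "\<psi> v + g v \<bullet> (u - v) \<le> \<psi> u"
      using that interior_subset by (auto intro!: convex_gradient_inequality[OF cvx])
    then show ?thesis
      by (simp add: inner_diff_left inner_diff_right inner_commute)
  qed
  with AE show ?thesis
    unfolding AE_monotone_def by (intro exI[of _ ?D]) auto
qed

lemma AE_monotone_cong:
  assumes "AE_monotone F T" "AE u in F. T' u = T u"
  shows "AE_monotone F T'"
proof -
  obtain D where "AE u in F. u \<in> D" "\<forall>u\<in>D. \<forall>v\<in>D. 0 \<le> (u - v) \<bullet> (T u - T v)"
    using assms(1) unfolding AE_monotone_def by blast
  with assms(2) show ?thesis
    unfolding AE_monotone_def by (intro exI[of _ "{u\<in>D. T' u = T u}"]) auto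
qed

section \<open>The essential graph as a closed monotone relation\<close>

definition ess_graph :: "'a::euclidean_space measure \<Rightarrow> ('a \<Rightarrow> 'a) \<Rightarrow> ('a \<times> 'a) set" where
  "ess_graph F T = msupport (distr F borel (\<lambda>u. (u, T u)))"

definition monotone_rel :: "('a::euclidean_space \<times> 'a) set \<Rightarrow> bool" where
  "monotone_rel G \<longleftrightarrow> (\<forall>(u, y)\<in>G. \<forall>(v, z)\<in>G. 0 \<le> (u - v) \<bullet> (y - z))"

lemma closed_ess_graph: "closed (ess_graph F T)"
  unfolding ess_graph_def by (rule closed_msupport)

lemma graph_measurable:
  fixes T :: "'a::second_countable_topology \<Rightarrow> 'b::second_countable_topology"
  assumes "sets F = sets borel" "T \<in> borel_measurable F"
  shows "(\<lambda>u. (u, T u)) \<in> borel_measurable F"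
  using assms(2) by (intro borel_measurable_Pair) (auto simp: measurable_ident_sets[OF assms(1)])

lemma AE_ess_graph:
  assumes "sets F = sets borel" "T \<in> borel_measurable F"
  shows "AE u in F. (u, T u) \<in> ess_graph F T"
proof -
  have "AE p in distr F borel (\<lambda>u. (u, T u)). p \<in> ess_graph F T"
    unfolding ess_graph_def by (rule AE_msupport) simp
  then show ?thesis
    by (rule AE_distrD[OF graph_measurable[OF assms]])
qed

lemma ess_graphD:
  assumes "sets F = sets borel" "T \<in> borel_measurable F"
    and "(x, y) \<in> ess_graph F T" "open S" "(x, y) \<in> S" 
  shows "0 < emeasure F {u \<in> space F. (u, T u) \<in> S}"
proof -
  have "0 < emeasure (distr F borel (\<lambda>u. (u, T u))) S"
    using assms(3-5) unfolding ess_graph_def msupport_def by auto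
  also have "\<dots> = emeasure F ((\<lambda>u. (u, T u)) -` S \<inter> space F)"
    using assms(4) by (intro emeasure_distr graph_measurable assms(1,2)) auto
  also have "(\<lambda>u. (u, T u)) -` S \<inter> space F = {u \<in> space F. (u, T u) \<in> S}"
    by auto
  finally show ?thesis .
qed

text \<open>Positivity brings measurability of the set with it, because \<open>emeasure\<close>
  vanishes outside the sigma-algebra.\<close>

lemma AE_emeasure_pos_ex:
  assumes "AE x in M. P x" "0 < emeasure M {x \<in> space M. R x}"
  shows "\<exists>x \<in> space M. P x \<and> R x"
proof (rule ccontr)
  assume "\<not> ?thesis"
  then have "AE x in M. \<not> R x"
    by (intro AE_mp[OF assms(1) AE_I2]) blast
  moreover have "{x \<in> space M. R x} \<in> sets M"
    using assms(2) emeasure_notin_sets[of "{x \<in> space M. R x}" M] by (metis less_irrefl)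
  ultimately have "emeasure M {x \<in> space M. R x} = 0"
    by (simp add: AE_iff_measurable[OF _ refl])
  with assms(2) show False by simp
qed

text \<open>Violating monotonicity is an open condition on pairs of points. A violating pair in the
  support would have neighbourhoods of positive mass, and hence nearby graph points over
  \<open>D\<close> violating it too.\<close>

lemma monotone_ess_graph:
  assumes F: "sets F = sets borel" "T \<in> borel_measurable F" and "AE_monotone F T"
  shows "monotone_rel (ess_graph F T)"
proof -
  obtain D where D: "AE u in F. u \<in> D" "\<And>u v. u \<in> D \<Longrightarrow> v \<in> D \<Longrightarrow> 0 \<le> (u - v) \<bullet> (T u - T v)"
    using assms(3) unfolding AE_monotone_def by blast
  have "0 \<le> (u - v) \<bullet> (y - z)" if uy: "(u, y) \<in> ess_graph F T" and vz: "(v, z) \<in> ess_graph F T" for u y v z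
  proof (rule ccontr)
    assume neg: "\<not> ?thesis"
    define W where "W = {(p, q). (fst p - fst q :: 'a) \<bullet> (snd p - snd q) < 0}"
    have "open W"
      unfolding W_def split_beta by (intro open_Collect_less continuous_intros)
    moreover have "((u, y), (v, z)) \<in> W"
      using neg by (simp add: W_def)
    ultimately obtain A B where AB: "open A" "open B" "(u, y) \<in> A" "(v, z) \<in> B" "A \<times> B \<subseteq> W"
      by (auto simp: open_prod_def)
    obtain u' where "u' \<in> D" "(u', T u') \<in> A"
      using AE_emeasure_pos_ex[OF D(1) ess_graphD[OF F uy AB(1,3)]] by blast
    moreover obtain v' where "v' \<in> D" "(v', T v') \<in> B"
      using AE_emeasure_pos_ex[OF D(1) ess_graphD[OF F vz AB(2,4)]] by blast
    ultimately have "((u', T u'), (v', T v')) \<in> W" "u' \<in> D" "v' \<in> D"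
      using AB(5) by auto
    then show False
      using D(2)[of u' v'] by (simp add: W_def)
  qed
  then show ?thesis
    by (auto simp: monotone_rel_def)
qed

section \<open>Lebesgue null sets and uniqueness of preimages\<close>

text \<open>The translates of \<open>S\<close> along \<open>e\<close> are disjoint, and infinitely many fit into one ball.\<close>
lemma null_sets_lborel_line_bounded:
  fixes S :: "'a::euclidean_space set"
  assumes S: "S \<in> sets borel" "bounded S" and "norm e = 1"
    and line: "\<And>x t. x \<in> S \<Longrightarrow> 0 < t \<Longrightarrow> x + t *\<^sub>R e \<notin> S"
  shows "S \<in> null_sets lborel"
proof -
  \<comment> \<open>Distinct shifts in \<open>(0, 1]\<close>: distinctness makes the translates
    \<open>A k\<close> of \<open>S\<close> disjoint, the bound 1 keeps them in the ball of radius
    \<open>r + 1\<close>.\<close>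
  define t where "t k = 1 / real (Suc k)" for k
  define A where "A k = (\<lambda>x. - (t k *\<^sub>R e) + x) -` S" for k
  obtain r where r: "S \<subseteq> cball 0 r"
    using S(2) by (auto simp: bounded_iff subset_iff)
  have sets: "A k \<in> sets lborel" for k
    using measurable_sets_borel[OF _ S(1), of "\<lambda>x. - (t k *\<^sub>R e) + x"] by (simp add: A_def)
  have A_eq: "emeasure lborel (A k) = emeasure lborel S" for k
  proof -
    have "emeasure lborel S = emeasure (distr lborel borel ((+) (- (t k *\<^sub>R e)))) S"
      by (subst lborel_distr_plus) simp
    also have "\<dots> = emeasure lborel ((+) (- (t k *\<^sub>R e)) -` S \<inter> space lborel)"
      using S(1) by (intro emeasure_distr) auto
    also have "(+) (- (t k *\<^sub>R e)) -` S \<inter> space lborel = A k"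
      by (auto simp: A_def)
    finally show ?thesis by simp
  qed
  have disj: "A k \<inter> A l = {}" if "t k < t l" for k l
  proof -
    have False if "x \<in> A k" "x \<in> A l" for x
    proof -
      \<comment> \<open>This point is \<open>x - t k *\<^sub>R e\<close>, rewritten as a positive
        shift of the point \<open>x - t l *\<^sub>R e\<close> of \<open>S\<close>.\<close>
      have "(- (t l *\<^sub>R e) + x) + (t l - t k) *\<^sub>R e \<in> S"
        using that(1) by (simp add: A_def algebra_simps)
      with line[of "- (t l *\<^sub>R e) + x" "t l - t k"] that(2) \<open>t k < t l\<close> show False
        by (simp add: A_def)
    qed
    then show ?thesis by blast
  qed
  have "disjoint_family A"
    unfolding disjoint_family_on_def
  proof (intro ballI impI)
    fix k l :: nat assume "k \<noteq> l"
    then have "t k < t l \<or> t l < t k"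
      by (auto simp: t_def neq_iff divide_simps)
    then show "A k \<inter> A l = {}"
      using disj[of k l] disj[of l k] by auto
  qed
  then have sum: "(\<Sum>k. emeasure lborel S) = emeasure lborel (\<Union>k. A k)"
    using suminf_emeasure[of A lborel] sets A_eq by auto
  have "(\<Union>k. A k) \<subseteq> cball 0 (r + 1)"
  proof (rule UN_least, rule subsetI)
    fix k x assume "x \<in> A k"
    then have "norm (- (t k *\<^sub>R e) + x) \<le> r"
      using r by (auto simp: A_def)
    moreover have "norm (t k *\<^sub>R e) \<le> 1"
      using \<open>norm e = 1\<close> by (simp add: t_def)
    moreover have "norm x \<le> norm (t k *\<^sub>R e) + norm (- (t k *\<^sub>R e) + x)"
      using norm_triangle_ineq[of "t k *\<^sub>R e" "- (t k *\<^sub>R e) + x"] by simp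
    ultimately show "x \<in> cball 0 (r + 1)" by simp
  qed
  then have "emeasure lborel (\<Union>k. A k) \<le> emeasure lborel (cball (0::'a) (r + 1))"
    by (intro emeasure_mono) auto
  also have "\<dots> < \<infinity>"
    by (rule emeasure_lborel_cball_finite)
  finally have fin: "(\<Sum>k::nat. emeasure lborel S) < \<infinity>"
    using sum by simp
  have "emeasure lborel S = 0"
  proof (rule ccontr)
    assume "emeasure lborel S \<noteq> 0"
    then have "(\<Sum>k::nat. emeasure lborel S) = \<infinity>"
      by (simp add: nn_integral_count_space_nat[symmetric] ennreal_mult_top)
    with fin show False by simp
  qed
  then show ?thesis
    using S(1) by (auto simp: null_sets_def)
qed

text \<open>The condition on lines passes to subsets, so the bounded case applies to the pieces of
  \<open>S\<close> in a countable family of balls.\<close>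

lemma null_sets_lborel_line:
  fixes S :: "'a::euclidean_space set"
  assumes S: "S \<in> sets borel" and "norm e = 1"
    and line: "\<And>x t. x \<in> S \<Longrightarrow> 0 < t \<Longrightarrow> x + t *\<^sub>R e \<notin> S"
  shows "S \<in> null_sets lborel"
proof -
  have "S \<inter> ball 0 (real n) \<in> null_sets lborel" for n
    using assms by (intro null_sets_lborel_line_bounded[where e = e]) auto
  then have "(\<Union>n. S \<inter> ball 0 (real n)) \<in> null_sets lborel"
    by (rule null_sets_UN)
  also have "(\<Union>n. S \<inter> ball 0 (real n)) = S"
    by (auto simp: reals_Archimedean2)
  finally show ?thesis .
qed

text \<open>If \<open>u\<close> and \<open>v\<close> are both paired with \<open>y\<close> and some rational interval \<open>[p, q]\<close> separates
  their \<open>b\<close>-coordinates, monotonicity excludes the same for \<open>y + t b\<close> with \<open>t > 0\<close>: the exceptional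
  set meets every line in direction \<open>b\<close> at most once.\<close>
lemma null_multivalued_inverse:
  fixes G :: "('a::euclidean_space \<times> 'a) set"
  assumes "closed G" and mono: "monotone_rel G"
  obtains N where "N \<in> null_sets lborel"
    and "\<And>u v y. (u, y) \<in> G \<Longrightarrow> (v, y) \<in> G \<Longrightarrow> u \<noteq> v \<Longrightarrow> y \<in> N"
proof -
  \<comment> \<open>The balls make the half-space pieces compact, so that their images under the
    closed relation \<open>G\<close> are closed and hence Borel.\<close>
  define L where "L n b q = cball 0 (real n) \<inter> {u::'a. u \<bullet> b \<le> real_of_rat q}" for n b q
  define R where "R n b q = cball 0 (real n) \<inter> {u::'a. real_of_rat q \<le> u \<bullet> b}" for n b q
  define P where "P C = {y. \<exists>u. u \<in> C \<and> (u, y) \<in> G}" for C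
  define N where "N = (\<Union>b\<in>Basis. \<Union>(p, q)\<in>{(p, q). p < q}. \<Union>n. P (L n b p) \<inter> P (R n b q))"
  have closedP: "closed (P C)" if "compact C" for C
    unfolding P_def by (rule closed_compact_projection[OF that \<open>closed G\<close>])
  have compact: "compact (L n b q)" "compact (R n b q)" for n b q
    unfolding L_def R_def
    by (auto intro!: compact_Int_closed closed_Collect_le continuous_intros)
  have "P (L n b p) \<inter> P (R n b q) \<in> null_sets lborel" if "b \<in> Basis" "p < q" for n b p q
  proof (rule null_sets_lborel_line[where e = b])
    show "P (L n b p) \<inter> P (R n b q) \<in> sets borel"
      by (intro borel_closed closed_Int closedP compact)
    show "norm b = 1" using that by simp
    fix y and t :: real assume y: "y \<in> P (L n b p) \<inter> P (R n b q)" and "0 < t"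
    show "y + t *\<^sub>R b \<notin> P (L n b p) \<inter> P (R n b q)"
    proof
      assume "y + t *\<^sub>R b \<in> P (L n b p) \<inter> P (R n b q)"
      then obtain v where v: "v \<in> L n b p" "(v, y + t *\<^sub>R b) \<in> G"
        by (auto simp: P_def)
      obtain u where u: "u \<in> R n b q" "(u, y) \<in> G"
        using y by (auto simp: P_def)
      have "0 \<le> (v - u) \<bullet> (y + t *\<^sub>R b - y)"
        using mono u(2) v(2) unfolding monotone_rel_def by blast
      then have "u \<bullet> b \<le> v \<bullet> b"
        using \<open>0 < t\<close> by (simp add: inner_diff_left zero_le_mult_iff)
      moreover have "real_of_rat p < real_of_rat q"
        using \<open>p < q\<close> by (simp add: of_rat_less)
      ultimately show False
        using u(1) v(1) by (auto simp: L_def R_def)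
    qed
  qed
  then have null: "N \<in> null_sets lborel"
    unfolding N_def by (intro null_sets_UN' null_sets_UN) (auto intro: countable_finite)
  have N: "y \<in> N" if "(u, y) \<in> G" "(v, y) \<in> G" "b \<in> Basis" and less: "u \<bullet> b < v \<bullet> b" for u v y b
  proof -
    obtain p where p: "u \<bullet> b < real_of_rat p" "real_of_rat p < v \<bullet> b"
      using of_rat_dense[OF less] by blast
    obtain q where q: "real_of_rat p < real_of_rat q" "real_of_rat q < v \<bullet> b"
      using of_rat_dense[OF p(2)] by blast
    obtain n where n: "max (norm u) (norm v) \<le> real n"
      using real_arch_simple by blast
    have "y \<in> P (L n b p) \<inter> P (R n b q)"
      using that p q n unfolding P_def L_def R_def
      by (intro IntI CollectI exI[of _ u] exI[of _ v]) auto
    moreover have "p < q" using q(1) by (simp add: of_rat_less)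
    ultimately show ?thesis
      using that(3) unfolding N_def by blast
  qed
  have "y \<in> N" if uv: "(u, y) \<in> G" "(v, y) \<in> G" "u \<noteq> v" for u v y
  proof -
    obtain b where b: "b \<in> Basis" "u \<bullet> b \<noteq> v \<bullet> b"
      using uv(3) by (auto simp: euclidean_eq_iff[of u v])
    then show ?thesis
      using N[OF uv(1,2) b(1)] N[OF uv(2,1) b(1)] by linarith
  qed
  with null show ?thesis
    by (rule that)
qed

text \<open>The values with several preimages form a Lebesgue null set. The law of \<open>T\<close>
  has a density, so it does not charge this set, and almost every \<open>T u\<close> avoids
  it.\<close>

lemma AE_ess_graph_unique:
  assumes F: "sets F = sets borel" "T \<in> borel_measurable F" and "AE_monotone F T"
    and dens: "has_lebesgue_density (distr F borel T)"
  shows "AE u in F. \<forall>v. (v, T u) \<in> ess_graph F T \<longrightarrow> v = u"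
proof -
  obtain N where N: "N \<in> null_sets lborel"
    and eq: "\<And>u v y. (u, y) \<in> ess_graph F T \<Longrightarrow> (v, y) \<in> ess_graph F T \<Longrightarrow> u \<noteq> v \<Longrightarrow> y \<in> N"
    using null_multivalued_inverse[OF closed_ess_graph monotone_ess_graph[OF assms(1-3)]] by metis
  obtain f where f: "f \<in> borel_measurable borel" "distr F borel T = density lborel f"
    using dens unfolding has_lebesgue_density_def by blast
  have "AE y in lborel. y \<notin> N"
    using N by (rule AE_not_in)
  then have "AE y in distr F borel T. y \<notin> N"
    unfolding f(2) using f(1) by (subst AE_density) auto
  then have "AE u in F. T u \<notin> N"
    by (rule AE_distrD[OF F(2)])
  with AE_ess_graph[OF F] show ?thesis
    by eventually_elim (use eq in blast)
qed

section \<open>A jointly measurable inverse\<close>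

text \<open>By compactness this detects, up to the boundary, whether the essential graph has a point
  \<open>(u, y)\<close> with \<open>u \<bullet> b\<close> below the rational and \<open>u\<close> in the ball. It involves only the measures
  of sets depending measurably on \<open>y\<close>, and on any parameter of \<open>T\<close>.\<close>
definition ess_fibre_meets :: "'a::euclidean_space measure \<Rightarrow> ('a \<Rightarrow> 'a) \<Rightarrow> 'a \<Rightarrow> 'a \<Rightarrow> rat \<times> nat \<Rightarrow> bool" where
  "ess_fibre_meets F T y b p \<longleftrightarrow> (\<forall>m. 0 < emeasure F {u \<in> space F.
     norm u < real (snd p) \<and> u \<bullet> b < real_of_rat (fst p) \<and> dist (T u) y < 1 / real (Suc m)})"

text \<open>The infimum is taken in \<open>ereal\<close>, with \<infinity> for rejected indices.
  Where it is infinite, \<open>real_of_ereal\<close> gives the default 0, so the function is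
  total.\<close>

definition ess_inverse :: "'a::euclidean_space measure \<Rightarrow> ('a \<Rightarrow> 'a) \<Rightarrow> 'a \<Rightarrow> 'a" where
  "ess_inverse F T y = (\<Sum>b\<in>Basis. real_of_ereal
     (INF p. if ess_fibre_meets F T y b p then ereal (real_of_rat (fst p)) else \<infinity>) *\<^sub>R b)"

text \<open>All inequalities are strict, so they cut out an open neighbourhood of
  \<open>(x, y)\<close>, which has positive mass.\<close>

lemma ess_fibre_meetsI:
  fixes F :: "'a::euclidean_space measure"
  assumes F: "sets F = sets borel" "T \<in> borel_measurable F"
    and x: "(x, y) \<in> ess_graph F T" and "norm x < real n" "x \<bullet> b < real_of_rat q"
  shows "ess_fibre_meets F T y b (q, n)"
  unfolding ess_fibre_meets_def
proof
  fix m
  define S where "S = {p::'a \<times> 'a. norm (fst p) < real n \<and> fst p \<bullet> b < real_of_rat q \<and>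
                        dist (snd p) y < 1 / real (Suc m)}"
  have "open S"
    unfolding S_def by (intro open_Collect_conj open_Collect_less continuous_intros)
  moreover have "(x, y) \<in> S"
    using assms(4,5) by (simp add: S_def)
  ultimately have "0 < emeasure F {u \<in> space F. (u, T u) \<in> S}"
    by (rule ess_graphD[OF F x])
  then show "0 < emeasure F {u \<in> space F. norm u < real (snd (q, n)) \<and>
      u \<bullet> b < real_of_rat (fst (q, n)) \<and> dist (T u) y < 1 / real (Suc m)}"
    by (simp add: S_def)
qed

text \<open>Positive mass for every \<open>m\<close> gives graph points over the compact set
  \<open>C\<close> with values tending to \<open>y\<close>. The image of \<open>C\<close> under the
  closed essential graph is closed, so it contains \<open>y\<close>. The strict bound weakens to
  \<le>, which does not change the infimum.\<close>

lemma ess_fibre_meetsD: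
  fixes F :: "'a::euclidean_space measure"
  assumes F: "sets F = sets borel" "T \<in> borel_measurable F"
    and meets: "ess_fibre_meets F T y b (q, n)"
  obtains u where "(u, y) \<in> ess_graph F T" "u \<bullet> b \<le> real_of_rat q"
proof -
  define C where "C = cball 0 (real n) \<inter> {u::'a. u \<bullet> b \<le> real_of_rat q}"
  let ?P = "{y. \<exists>u. u \<in> C \<and> (u, y) \<in> ess_graph F T}"
  have "compact C"
    unfolding C_def by (auto intro!: compact_Int_closed closed_Collect_le continuous_intros)
  then have "closed ?P"
    by (rule closed_compact_projection[OF _ closed_ess_graph])
  moreover have "y \<in> closure ?P"
    unfolding closure_approachable
  proof (intro allI impI)
    fix e :: real assume "0 < e"
    then obtain m where m: "1 / real (Suc m) < e"
      by (rule nat_approx_posE)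
    have "0 < emeasure F {u \<in> space F. norm u < real n \<and> u \<bullet> b < real_of_rat q \<and>
        dist (T u) y < 1 / real (Suc m)}"
      using meets by (simp add: ess_fibre_meets_def)
    from AE_emeasure_pos_ex[OF AE_ess_graph[OF F] this] obtain u where
      "(u, T u) \<in> ess_graph F T" "norm u < real n" "u \<bullet> b < real_of_rat q" "dist (T u) y < 1 / real (Suc m)"
      by blast
    moreover from this have "T u \<in> ?P"
      by (intro CollectI exI[of _ u]) (simp add: C_def)
    ultimately show "\<exists>y'\<in>?P. dist y' y < e"
      using m by (meson order_less_trans)
  qed
  ultimately have "y \<in> ?P"
    by (simp only: closure_closed)
  then obtain u where "u \<in> C" "(u, y) \<in> ess_graph F T"
    by blast
  then show ?thesis
    by (intro that[of u]) (simp_all add: C_def)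
qed

text \<open>Rationals just above \<open>x \<bullet> b\<close> are accepted, with a ball large enough
  to hold \<open>x\<close>. Every accepted rational bounds the coordinate of some preimage, which
  can only be \<open>x\<close>.\<close>

lemma ess_inverse_eq:
  fixes F :: "'a::euclidean_space measure"
  assumes F: "sets F = sets borel" "T \<in> borel_measurable F"
    and x: "(x, y) \<in> ess_graph F T" and uniq: "\<And>v. (v, y) \<in> ess_graph F T \<Longrightarrow> v = x"
  shows "ess_inverse F T y = x"
proof -
  have "(INF p. if ess_fibre_meets F T y b p then ereal (real_of_rat (fst p)) else \<infinity>) = ereal (x \<bullet> b)"
    (is "(INF p. ?f p) = _") for b
  proof (rule antisym)
    show "(INF p. ?f p) \<le> ereal (x \<bullet> b)"
    proof (rule ereal_le_epsilon2)
      fix e :: real assume "0 < e"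
      then obtain q where q: "x \<bullet> b < real_of_rat q" "real_of_rat q < x \<bullet> b + e"
        using of_rat_dense[of "x \<bullet> b" "x \<bullet> b + e"] by auto
      obtain n where "norm x < real n"
        using reals_Archimedean2 by blast
      then have "ess_fibre_meets F T y b (q, n)"
        using q by (intro ess_fibre_meetsI[OF F x])
      then have "?f (q, n) \<le> ereal (x \<bullet> b) + ereal e"
        using q by simp
      then show "(INF p. ?f p) \<le> ereal (x \<bullet> b) + ereal e"
        by (rule INF_lower2[OF UNIV_I])
    qed
    show "ereal (x \<bullet> b) \<le> (INF p. ?f p)"
    proof (rule INF_greatest)
      fix p :: "rat \<times> nat"
      have "x \<bullet> b \<le> real_of_rat (fst p)" if "ess_fibre_meets F T y b p"
        using ess_fibre_meetsD[OF F, of y b "fst p" "snd p"] that uniq by auto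
      then show "ereal (x \<bullet> b) \<le> ?f p"
        by simp
    qed
  qed
  then show ?thesis
    by (simp add: ess_inverse_def euclidean_representation)
qed

lemma AE_ess_inverse:
  assumes F: "sets F = sets borel" "T \<in> borel_measurable F" and "AE_monotone F T"
    and dens: "has_lebesgue_density (distr F borel T)"
  shows "AE u in F. ess_inverse F T (T u) = u"
  using AE_ess_graph[OF F] AE_ess_graph_unique[OF assms]
  by eventually_elim (auto intro: ess_inverse_eq[OF F])

text \<open>The measure of a section of a measurable set depends measurably on the parameter. The
  rest is a countable quantifier, a countable infimum and a finite sum.\<close>

lemma measurable_ess_inverse:
  fixes F :: "'a::euclidean_space measure" and Q :: "'a \<times> 'b::euclidean_space \<Rightarrow> 'a"
  assumes "sigma_finite_measure F" and F: "sets F = sets borel"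
    and Q: "Q \<in> borel_measurable borel"
  shows "(\<lambda>p. ess_inverse F (\<lambda>u. Q (u, snd p)) (fst p)) \<in> borel_measurable borel"
proof -
  interpret sigma_finite_measure F by fact
  let ?N = "(borel :: 'a measure) \<Otimes>\<^sub>M (borel :: 'b measure)"
  have snd[measurable]: "snd \<in> ?N \<Otimes>\<^sub>M F \<rightarrow>\<^sub>M borel"
    using measurable_snd[of ?N F] by (simp add: measurable_cong_sets[OF refl F])
  have [measurable]: "(\<lambda>x. Q (snd x, snd (fst x))) \<in> borel_measurable (?N \<Otimes>\<^sub>M F)"
    by (rule measurable_compose[OF borel_measurable_Pair Q]) measurable
  have [measurable]: "(\<lambda>p. emeasure F {u \<in> space F. norm u < real n \<and> u \<bullet> b < real_of_rat q \<and>
      dist (Q (u, snd p)) (fst p) < 1 / real (Suc m)}) \<in> borel_measurable ?N" for n b q m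
  proof (rule measurable_emeasure)
    have "{x \<in> space (?N \<Otimes>\<^sub>M F). snd x \<in> {u \<in> space F. norm u < real n \<and> u \<bullet> b < real_of_rat q \<and>
        dist (Q (u, snd (fst x))) (fst (fst x)) < 1 / real (Suc m)}} =
      {x \<in> space (?N \<Otimes>\<^sub>M F). norm (snd x) < real n \<and> snd x \<bullet> b < real_of_rat q \<and>
        dist (Q (snd x, snd (fst x))) (fst (fst x)) < 1 / real (Suc m)}"
      by (auto simp: space_pair_measure)
    also have "\<dots> \<in> sets (?N \<Otimes>\<^sub>M F)"
      by measurable
    finally show "{x \<in> space (?N \<Otimes>\<^sub>M F). snd x \<in> {u \<in> space F. norm u < real n \<and> u \<bullet> b < real_of_rat q \<and>
      dist (Q (u, snd (fst x))) (fst (fst x)) < 1 / real (Suc m)}} \<in> sets (?N \<Otimes>\<^sub>M F)" .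
  qed auto
  have [measurable]: "Measurable.pred ?N (\<lambda>p. ess_fibre_meets F (\<lambda>u. Q (u, snd p)) (fst p) b i)" for b i
    unfolding ess_fibre_meets_def by measurable
  have "(\<lambda>p. ess_inverse F (\<lambda>u. Q (u, snd p)) (fst p)) \<in> borel_measurable ?N"
    unfolding ess_inverse_def by measurable
  then show ?thesis
    by (simp add: borel_prod)
qed

section \<open>Pushforward laws and transfer to the random vectors\<close>

text \<open>A non-measurable preimage has \<^const>\<open>emeasure\<close> zero, as has its complement, so
  \<^const>\<open>distr\<close> would lose mass.\<close>
lemma measurable_distr_prob:
  assumes "prob_space (distr F N f)" "f \<in> space F \<rightarrow> space N"
  shows "f \<in> F \<rightarrow>\<^sub>M N"
proof (rule measurableI)
  show "f x \<in> space N" if "x \<in> space F" for x using assms(2) that by auto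
  fix A assume A: "A \<in> sets N"
  interpret D: prob_space "distr F N f" by fact
  let ?\<mu> = "\<lambda>A. emeasure F (f -` A \<inter> space F)"
  \<comment> \<open>\<open>distr\<close> degenerates to the zero measure when \<open>?\<mu>\<close>
    is not a measure on \<open>N\<close>; total mass one excludes this.\<close>
  have em: "emeasure (distr F N f) B = ?\<mu> B" if "B \<in> sets N" for B
    using D.emeasure_space_1 that unfolding distr_def
    by (auto simp: emeasure_measure_of_conv sets.sigma_sets_eq split: if_splits)
  show "f -` A \<inter> space F \<in> sets F"
  proof (rule ccontr)
    assume neg: "f -` A \<inter> space F \<notin> sets F"
    have "f -` (space N - A) \<inter> space F = space F - (f -` A \<inter> space F)"
      using assms(2) by auto
    moreover have "space F - (space F - (f -` A \<inter> space F)) = f -` A \<inter> space F"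
      by auto
    ultimately have neg': "f -` (space N - A) \<inter> space F \<notin> sets F"
      using neg by (metis sets.compl_sets)
    have "1 = emeasure (distr F N f) (A \<union> (space N - A))"
      using D.emeasure_space_1 sets.sets_into_space[OF A] by (simp add: Un_absorb1)
    also have "\<dots> = emeasure (distr F N f) A + emeasure (distr F N f) (space N - A)"
      using A by (intro plus_emeasure[symmetric]) auto
    also have "\<dots> = 0"
      using A neg neg' by (simp add: em emeasure_notin_sets)
    finally show False by simp
  qed
qed

text \<open>Both laws are compared on rectangles, which generate the Borel sets and are stable under
  intersection. There the conditional law integrates to the same value as the sections of the
  product measure.\<close>

lemma cond_distr_pushforward:
  fixes Y :: "'w \<Rightarrow> 'a::euclidean_space" and Z :: "'w \<Rightarrow> 'b::euclidean_space"
    and Q :: "'a \<times> 'b \<Rightarrow> 'a"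
  assumes M: "prob_space M" and F: "prob_space F" "sets F = sets borel"
    and Y[measurable]: "Y \<in> borel_measurable M" and Z[measurable]: "Z \<in> borel_measurable M"
    and Q: "Q \<in> borel_measurable borel" and K: "cond_distr M Y Z K"
    and KQ: "AE z in distr M borel Z. K z = distr F borel (\<lambda>u. Q (u, z))"
  shows "distr M borel (\<lambda>\<omega>. (Y \<omega>, Z \<omega>)) =
    distr (F \<Otimes>\<^sub>M distr M borel Z) borel (\<lambda>p. (Q p, snd p))" (is "?L = distr ?P borel ?h")
proof -
  interpret M: prob_space M by fact
  interpret F: prob_space F by fact
  interpret Z: prob_space "distr M borel Z" by (rule M.prob_space_distr) fact
  interpret FZ: pair_prob_space F "distr M borel Z" ..
  have setsP: "sets ?P = sets (borel :: ('a \<times> 'b) measure)"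
    unfolding borel_prod[symmetric] using F(2) by (intro sets_pair_measure_cong) auto
  have snd: "snd \<in> borel_measurable (borel :: ('a \<times> 'b) measure)"
    by (intro borel_measurable_continuous_onI continuous_intros)
  have h: "?h \<in> borel_measurable ?P"
    unfolding measurable_cong_sets[OF setsP refl] using Q snd by (rule borel_measurable_Pair)
  let ?E = "{A \<times> B | A B. A \<in> sets (borel :: 'a measure) \<and> B \<in> sets (borel :: 'b measure)}"
  show ?thesis
  proof (rule measure_eqI_generator_eq[where E = ?E and \<Omega> = UNIV and A = "\<lambda>_. UNIV"])
    show "Int_stable ?E"
      using Int_stable_pair_measure_generator[of "borel :: 'a measure" "borel :: 'b measure"] by simp
    have *: "sets (borel :: ('a \<times> 'b) measure) = sigma_sets UNIV ?E"
      unfolding borel_prod[symmetric] sets_pair_measure by simp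
    show "sets ?L = sigma_sets UNIV ?E" "sets (distr ?P borel ?h) = sigma_sets UNIV ?E"
      using * by simp_all
    show "emeasure ?L UNIV \<noteq> \<infinity>"
      using M.emeasure_space_1 by (subst emeasure_distr) auto
    show "range (\<lambda>_. UNIV) \<subseteq> ?E"
      by (auto intro!: exI[of _ UNIV])
    fix X assume "X \<in> ?E"
    then obtain A B where X: "X = A \<times> B" and A: "A \<in> sets borel" and B: "B \<in> sets borel"
      by blast
    have AB: "A \<times> B \<in> sets borel"
      unfolding borel_prod[symmetric] using A B by (rule pair_measureI)
    have "emeasure ?L X = emeasure M {\<omega> \<in> space M. Y \<omega> \<in> A \<and> Z \<omega> \<in> B}"
      unfolding X using AB by (subst emeasure_distr) (auto intro!: arg_cong[where f = "emeasure M"])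
    also have "\<dots> = (\<integral>\<^sup>+ z. indicator B z * emeasure (K z) A \<partial>distr M borel Z)"
      using K A B unfolding cond_distr_def by blast
    also have "\<dots> = (\<integral>\<^sup>+ z. emeasure F ((\<lambda>u. (u, z)) -` (?h -` X \<inter> space ?P)) \<partial>distr M borel Z)"
    proof (rule nn_integral_cong_AE)
      show "AE z in distr M borel Z. indicator B z * emeasure (K z) A =
              emeasure F ((\<lambda>u. (u, z)) -` (?h -` X \<inter> space ?P))"
        using KQ
      proof eventually_elim
        fix z assume Kz: "K z = distr F borel (\<lambda>u. Q (u, z))"
        have "(\<lambda>u. Q (u, z)) \<in> borel_measurable borel"
          by (rule measurable_compose[OF _ Q]) simp
        then have "(\<lambda>u. Q (u, z)) \<in> borel_measurable F"
          by (simp add: measurable_cong_sets[OF F(2) refl])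
        then have "emeasure (K z) A = emeasure F ((\<lambda>u. Q (u, z)) -` A \<inter> space F)"
          unfolding Kz using A by (rule emeasure_distr)
        moreover have "(\<lambda>u. (u, z)) -` (?h -` X \<inter> space ?P) =
            (if z \<in> B then (\<lambda>u. Q (u, z)) -` A \<inter> space F else {})"
          by (auto simp: X space_pair_measure)
        ultimately show "indicator B z * emeasure (K z) A =
            emeasure F ((\<lambda>u. (u, z)) -` (?h -` X \<inter> space ?P))"
          by simp
      qed
    qed
    also have "\<dots> = emeasure ?P (?h -` X \<inter> space ?P)"
      using AB by (intro FZ.emeasure_pair_measure_alt2[symmetric] measurable_sets[OF h]) (simp add: X)
    also have "\<dots> = emeasure (distr ?P borel ?h) X"
      using AB by (intro emeasure_distr[symmetric] h) (simp add: X)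
    finally show "emeasure ?L X = emeasure (distr ?P borel ?h) X" .
  qed auto
qed

text \<open>With \<open>?h\<close> and \<open>?g\<close> as below, \<open>(Y, Z)\<close> has the law
  of \<open>?h\<close> under the product measure, and \<open>?g\<close> undoes \<open>?h\<close>
  almost everywhere. Hence \<open>?g\<close> carries that law back to the product measure, which
  expresses independence.\<close>

lemma cond_distr_inverse:
  fixes Y :: "'w \<Rightarrow> 'a::euclidean_space" and Z :: "'w \<Rightarrow> 'b::euclidean_space"
    and Q G :: "'a \<times> 'b \<Rightarrow> 'a"
  assumes M: "prob_space M" and F: "prob_space F" "sets F = sets borel"
    and Y[measurable]: "Y \<in> borel_measurable M" and Z[measurable]: "Z \<in> borel_measurable M"
    and Q: "Q \<in> borel_measurable borel" and G: "G \<in> borel_measurable borel"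
    and K: "cond_distr M Y Z K"
    and KQ: "AE z in distr M borel Z. K z = distr F borel (\<lambda>u. Q (u, z))"
    and inv: "AE z in distr M borel Z. AE u in F. G (Q (u, z), z) = u"
  shows "distr M borel (\<lambda>\<omega>. (G (Y \<omega>, Z \<omega>), Z \<omega>)) = F \<Otimes>\<^sub>M distr M borel Z"
    and "AE \<omega> in M. Y \<omega> = Q (G (Y \<omega>, Z \<omega>), Z \<omega>)"
proof -
  interpret M: prob_space M by fact
  interpret F: prob_space F by fact
  interpret Z: prob_space "distr M borel Z" by (rule M.prob_space_distr) fact
  interpret FZ: pair_prob_space F "distr M borel Z" ..
  let ?P = "F \<Otimes>\<^sub>M distr M borel Z"
  let ?h = "\<lambda>p. (Q p, snd p)" and ?g = "\<lambda>p. (G p, snd p)"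
  note law = cond_distr_pushforward[OF M F Y Z Q K KQ]
  have setsP: "sets ?P = sets (borel :: ('a \<times> 'b) measure)"
    unfolding borel_prod[symmetric] using F(2) by (intro sets_pair_measure_cong) auto
  have fst: "fst \<in> borel_measurable (borel :: ('a \<times> 'b) measure)"
    and snd: "snd \<in> borel_measurable (borel :: ('a \<times> 'b) measure)"
    by (intro borel_measurable_continuous_onI continuous_intros)+
  have h: "?h \<in> borel_measurable borel" and g: "?g \<in> borel_measurable borel"
    using Q G snd by (auto intro: borel_measurable_Pair)
  have hP: "?h \<in> borel_measurable ?P"
    unfolding measurable_cong_sets[OF setsP refl] by (rule h)
  have YZ: "(\<lambda>\<omega>. (Y \<omega>, Z \<omega>)) \<in> borel_measurable M"
    by measurable
  have Gh: "(\<lambda>p. G (?h p)) \<in> borel_measurable borel"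
    by (rule measurable_compose[OF h G])
  have "AE p in ?P. G (Q p, snd p) = fst p"
  proof (rule FZ.AE_pair_measure)
    have "{p \<in> space borel. G (?h p) = fst p} \<in> sets borel"
      using Gh fst by (rule measurable_equality_set)
    then have meas: "{p \<in> space ?P. G (?h p) = fst p} \<in> sets ?P"
      using setsP sets_eq_imp_space_eq[OF setsP] by simp
    then show "{p \<in> space ?P. G (Q p, snd p) = fst p} \<in> sets ?P" .
    \<comment> \<open>\<open>inv\<close> quantifies over \<open>z\<close> first; measurability of
      the exceptional set permits the exchange.\<close>
    show "AE u in F. AE z in distr M borel Z. G (Q (u, z), snd (u, z)) = fst (u, z)"
      using FZ.AE_commute[of "\<lambda>u z. G (Q (u, z), z) = u"] meas inv by simp
  qed
  then have inv': "AE p in ?P. ?g (?h p) = p"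
    by eventually_elim (simp add: prod_eq_iff)
  have "distr M borel (\<lambda>\<omega>. (G (Y \<omega>, Z \<omega>), Z \<omega>)) = distr (distr M borel (\<lambda>\<omega>. (Y \<omega>, Z \<omega>))) borel ?g"
    by (subst distr_distr[OF g YZ]) (simp add: comp_def)
  also have "\<dots> = distr ?P borel (\<lambda>p. ?g (?h p))"
    unfolding law by (subst distr_distr[OF g hP]) (simp add: comp_def)
  also have "\<dots> = distr ?P borel (\<lambda>p. p)"
    using inv' measurable_compose[OF hP g]
    by (intro distr_cong_AE) (auto simp: measurable_ident_sets[OF setsP])
  also have "\<dots> = ?P"
    by (rule distr_id2[OF setsP[symmetric]])
  finally show "distr M borel (\<lambda>\<omega>. (G (Y \<omega>, Z \<omega>), Z \<omega>)) = ?P" .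
  have "AE p in ?P. fst (?h p) = Q (?g (?h p))"
    using inv' by eventually_elim simp
  moreover have meas: "{p \<in> space borel. fst p = Q (?g p)} \<in> sets borel"
    using fst measurable_compose[OF g Q] by (rule measurable_equality_set)
  ultimately have "AE p in distr ?P borel ?h. fst p = Q (?g p)"
    by (subst AE_distr_iff[OF hP]) auto
  then have "AE p in distr M borel (\<lambda>\<omega>. (Y \<omega>, Z \<omega>)). fst p = Q (?g p)"
    unfolding law .
  from AE_distrD[OF YZ this] show "AE \<omega> in M. Y \<omega> = Q (G (Y \<omega>, Z \<omega>), Z \<omega>)"
    by simp
qed

section \<open>The inverse quantile map and the representation of \<open>Y\<close>\<close>

theorem theorem2p2:
  fixes M0 :: "'w0 measure" and M1 :: "'w1 measure"
    and Y1 :: "'w1 \<Rightarrow> real^'d::finite" and Z1 :: "'w1 \<Rightarrow> real^'k::finite"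
    and F_U :: "(real^'d) measure"
    and K :: "real^'k \<Rightarrow> (real^'d) measure"
    and Q :: "((real^'d) \<times> (real^'k)) \<Rightarrow> real^'d"
  defines "M \<equiv> M0 \<Otimes>\<^sub>M (M1 \<Otimes>\<^sub>M restrict_space lborel {0<..<(1::real)})"
    and "Y \<equiv> (\<lambda>\<omega>. Y1 (fst (snd \<omega>)))"
    and "Z \<equiv> (\<lambda>\<omega>. Z1 (fst (snd \<omega>)))"
  assumes M0: "prob_space M0" and M1: "prob_space M1"
    and Y1: "Y1 \<in> borel_measurable M1" and Z1: "Z1 \<in> borel_measurable M1"
    and FU_prob: "prob_space F_U" and FU_dens: "has_lebesgue_density F_U"
    and FU_conv: "convex (msupport F_U)"
    and M0_carries: "\<exists>V \<in> borel_measurable M0. distr M0 borel V = F_U"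
    and K: "cond_distr M Y Z K"
    and K_dens: "\<forall>z \<in> msupport (distr M borel Z). has_lebesgue_density (K z)"
    and Q_meas: "Q \<in> borel_measurable
                   (restrict_space borel (msupport (F_U \<Otimes>\<^sub>M distr M borel Z)))"
    and Q_grad: "\<forall>z \<in> msupport (distr M borel Z).
                   ae_gradient_of_convex F_U (\<lambda>u. Q (u, z)) \<and>
                   distr F_U borel (\<lambda>u. Q (u, z)) = K z"
  shows "\<exists>Qinv :: ((real^'d) \<times> (real^'k)) \<Rightarrow> real^'d.
           Qinv \<in> borel_measurable
                   (restrict_space borel (msupport (distr M borel (\<lambda>\<omega>. (Y \<omega>, Z \<omega>))))) \<and>
           (\<forall>z \<in> msupport (distr M borel Z). AE u in F_U. Qinv (Q (u, z), z) = u) \<and>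
           (let U = (\<lambda>\<omega>. Qinv (Y \<omega>, Z \<omega>)) in
              U \<in> borel_measurable M \<and>
              distr M borel (\<lambda>\<omega>. (U \<omega>, Z \<omega>)) = F_U \<Otimes>\<^sub>M distr M borel Z \<and>
              (AE \<omega> in M. Y \<omega> = Q (U \<omega>, Z \<omega>)))"
proof -
  let ?I = "restrict_space lborel {0<..<(1::real)}"
  interpret M0: prob_space M0 by fact
  interpret M1: prob_space M1 by fact
  interpret I: prob_space ?I
    by (rule prob_spaceI) (simp add: emeasure_restrict_space space_restrict_space)
  interpret M1I: pair_prob_space M1 ?I ..
  interpret MM: pair_prob_space M0 "M1 \<Otimes>\<^sub>M ?I" ..
  have M: "prob_space M"
    unfolding M_def by (rule MM.prob_space_axioms)
  have YM: "Y \<in> borel_measurable M" and ZM: "Z \<in> borel_measurable M"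
    unfolding Y_def Z_def M_def using Y1 Z1 by measurable
  interpret F: prob_space F_U by fact
  interpret Z: prob_space "distr M borel Z"
    by (rule prob_space.prob_space_distr[OF M ZM])
  have setsF: "sets F_U = sets borel"
    using FU_dens by (auto simp: has_lebesgue_density_def)
  define S where "S = msupport (F_U \<Otimes>\<^sub>M distr M borel Z)"
  \<comment> \<open>\<open>Q\<close> is measurable only on \<open>S\<close>. Extension by 0 gives a
    Borel map on the whole space whose sections over the support of \<open>Z\<close> agree with
    those of \<open>Q\<close> almost everywhere.\<close>
  define Q' where "Q' p = (if p \<in> S then Q p else 0)" for p
  have "S \<in> sets borel"
    unfolding S_def by (intro borel_closed closed_msupport)
  then have Q': "Q' \<in> borel_measurable borel"
    using Q_meas measurable_restrict_space_iff[of S borel 0 borel Q]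
    unfolding S_def[symmetric] Q'_def[abs_def] by simp
  have Q'_section: "(\<lambda>u. Q' (u, z)) \<in> borel_measurable F_U" for z
    unfolding measurable_cong_sets[OF setsF refl] by (rule measurable_compose[OF _ Q']) simp
  define Qinv where "Qinv p = ess_inverse F_U (\<lambda>u. Q' (u, snd p)) (fst p)" for p
  have Qinv: "Qinv \<in> borel_measurable borel"
    using measurable_ess_inverse[OF F.sigma_finite_measure_axioms setsF Q']
    by (simp add: Qinv_def[abs_def])
  have QQ': "AE u in F_U. Q' (u, z) = Q (u, z)" if "z \<in> msupport (distr M borel Z)" for z
    using AE_msupport[OF setsF]
  proof eventually_elim
    case (elim u)
    then have "(u, z) \<in> S"
      unfolding S_def
      by (intro msupport_pair_measure that setsF sets_distr Z.sigma_finite_measure_axioms)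
    then show ?case by (simp add: Q'_def)
  qed
  have KQ': "K z = distr F_U borel (\<lambda>u. Q' (u, z))" if z: "z \<in> msupport (distr M borel Z)" for z
  proof -
    have Kz: "distr F_U borel (\<lambda>u. Q (u, z)) = K z"
      using Q_grad z by blast
    moreover have "prob_space (K z)"
      using K unfolding cond_distr_def by blast
    \<comment> \<open>Off \<open>S\<close> the section could be arbitrary; its measurability is
      recovered from the fact that its \<open>distr\<close> is a probability measure.\<close>
    ultimately have "(\<lambda>u. Q (u, z)) \<in> borel_measurable F_U"
      by (intro measurable_distr_prob) auto
    with QQ'[OF z] have "distr F_U borel (\<lambda>u. Q' (u, z)) = distr F_U borel (\<lambda>u. Q (u, z))"
      by (intro distr_cong_AE Q'_section) auto
    with Kz show ?thesis by simp
  qed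
  have inv': "AE u in F_U. Qinv (Q' (u, z), z) = u" if z: "z \<in> msupport (distr M borel Z)" for z
  proof -
    have "AE_monotone F_U (\<lambda>u. Q' (u, z))"
      using Q_grad z by (intro AE_monotone_cong[OF AE_monotone_gradient QQ'[OF z]]) blast
    moreover have "has_lebesgue_density (distr F_U borel (\<lambda>u. Q' (u, z)))"
      using K_dens z unfolding KQ'[OF z, symmetric] by blast
    ultimately show ?thesis
      using AE_ess_inverse[OF setsF Q'_section] by (simp add: Qinv_def)
  qed
  have inv: "\<forall>z \<in> msupport (distr M borel Z). AE u in F_U. Qinv (Q (u, z), z) = u"
  proof
    fix z assume z: "z \<in> msupport (distr M borel Z)"
    show "AE u in F_U. Qinv (Q (u, z), z) = u"
      using QQ'[OF z] inv'[OF z] by eventually_elim simp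
  qed
  have supp: "AE z in distr M borel Z. z \<in> msupport (distr M borel Z)"
    by (rule AE_msupport) simp
  have U: "(\<lambda>\<omega>. Qinv (Y \<omega>, Z \<omega>)) \<in> borel_measurable M"
    by (rule measurable_compose[OF borel_measurable_Pair[OF YM ZM] Qinv])
  have KQ'_AE: "AE z in distr M borel Z. K z = distr F_U borel (\<lambda>u. Q' (u, z))"
    using supp by eventually_elim (rule KQ')
  have inv'_AE: "AE z in distr M borel Z. AE u in F_U. Qinv (Q' (u, z), z) = u"
    using supp by eventually_elim (rule inv')
  note U_facts = cond_distr_inverse[OF M FU_prob setsF YM ZM Q' Qinv K KQ'_AE inv'_AE]
  note law = U_facts(1) and YQ' = U_facts(2)
  \<comment> \<open>Returning from \<open>Q'\<close> to \<open>Q\<close>: the law of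
    \<open>(U, Z)\<close> is the product measure, so almost surely the pair lies in its support
    \<open>S\<close>, where the two maps coincide.\<close>
  have "AE p in distr M borel (\<lambda>\<omega>. (Qinv (Y \<omega>, Z \<omega>), Z \<omega>)). p \<in> S"
    unfolding S_def law[symmetric] by (rule AE_msupport) simp
  then have "AE \<omega> in M. (Qinv (Y \<omega>, Z \<omega>), Z \<omega>) \<in> S"
    by (rule AE_distrD[OF borel_measurable_Pair[OF U ZM]])
  with YQ' have "AE \<omega> in M. Y \<omega> = Q (Qinv (Y \<omega>, Z \<omega>), Z \<omega>)"
    by eventually_elim (simp add: Q'_def)
  with U law inv measurable_restrict_space1[OF Qinv] show ?thesis
    by (intro exI[of _ Qinv]) (simp add: Let_def)
qed

end
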